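(* Under periodic boundary conditions, the full-discrete stochastic multi-symplectic wavelet collocation method for the stochastic Maxwell equations with multiplicative noise, as given in the context, has the following discrete energy conservation law: for all $n$, $$\|\mathbf{E}^{n+1}\|^2+\|\mathbf{H}^{n+1}\|^2=\|\mathbf{E}^{n}\|^2+\|\mathbf{H}^{n}\|^2\quad\text{almost surely},$$ where $$\|\mathbf{E}^n\|^2=\Delta x\,\Delta y\,\Delta z\sum_{i=1}^{N_1}\sum_{j=1}^{N_2}\sum_{k=1}^{N_3}\Big((E^n_{1_{i,j,k}})^2+(E^n_{2_{i,j,k}})^2+(E^n_{3_{i,j,k}})^2\Big),$$ $$\|\mathbf{H}^n\|^2=\Delta x\,\Delta y\,\Delta z\sum_{i=1}^{N_1}\sum_{j=1}^{N_2}\sum_{k=1}^{N_3}\Big((H^n_{1_{i,j,k}})^2+(H^n_{2_{i,j,k}})^2+(H^n_{3_{i,j,k}})^2\Big).$$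
   Context: Grid: the spatial domain is $[0,L_1]\times[0,L_2]\times[0,L_3]$ with $N_s=L_s2^{J_s}$ ($s=1,2,3$) collocation points per direction, $(x_i,y_j,z_k)=(i/2^{J_1},j/2^{J_2},k/2^{J_3})$, $1\le i\le N_1$, $1\le j\le N_2$, $1\le k\le N_3$; $\Delta x=2^{-J_1}$, $\Delta y=2^{-J_2}$, $\Delta z=2^{-J_3}$. Spatial indices are read periodically (modulo $N_1,N_2,N_3$ respectively). $\Delta t>0$ is the time step, $\lambda\ge0$ is a constant, and $v^{n+1/2}=\frac12(v^n+v^{n+1})$. Differentiation matrices: let $\gamma$ be a positive even integer and $\phi$ the Daubechies scaling function of order $\gamma$, satisfying $\phi(x)=\sum_{k=0}^{\gamma-1}h_k\phi(2x-k)$ with $\gamma$ non-vanishing filter coefficients $h_k$. Let $\theta(x)=\int\phi(t)\phi(t-x)\,dt$ be its autocorrelation function; $\gamma$ is such that $\theta$ is differentiable, and $N_s\ge 2\gamma-1$. The matrix $B^y$ is the $N_2\times N_2$ skew-symmetric circulant matrix with entries $$(B^y)_{m,m'}=\begin{cases}2^{J_2}\theta'(m-m'),& m-(\gamma-1)\le m'\le m+(\gamma-1),\\ 2^{J_2}\theta'(-l),& m-m'=N_2-l,\ 1\le l\le\gamma-1,\\ 2^{J_2}\theta'(l),& m'-m=N_2-l,\ 1\le l\le\gamma-1,\\ 0,&\text{otherwise,}\end{cases}$$ and $B^x$ ($N_1\times N_1$, with $J_1$) and $B^z$ ($N_3\times N_3$, with $J_3$) are defined in the same way. Operators on grid functions: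 $A_1=B^x\otimes I_{N_2}\otimes I_{N_3}$, $A_2=I_{N_1}\otimes B^y\otimes I_{N_3}$, $A_3=I_{N_1}\otimes I_{N_2}\otimes B^z$, meaning $(A_1v)_{i,j,k}=\sum_{i'}(B^x)_{i,i'}v_{i',j,k}$, $(A_2v)_{i,j,k}=\sum_{j'}(B^y)_{j,j'}v_{i,j',k}$, $(A_3v)_{i,j,k}=\sum_{k'}(B^z)_{k,k'}v_{i,j,k'}$. The method: for grid functions $\mathbf{E}_s=(E_{s_{i,j,k}})$ and $\mathbf{H}_s=(H_{s_{i,j,k}})$, $s=1,2,3$, $$\begin{aligned} \mathbf{E}_1^{n+1}-\mathbf{E}_1^{n}&=\Delta t\,(A_2\mathbf{H}_3^{n+1/2}-A_3\mathbf{H}_2^{n+1/2})-\lambda\mathbf{H}_1^{n+1/2}\mathbf{W}^n,\\ \mathbf{E}_2^{n+1}-\mathbf{E}_2^{n}&=\Delta t\,(A_3\mathbf{H}_1^{n+1/2}-A_1\mathbf{H}_3^{n+1/2})-\lambda\mathbf{H}_2^{n+1/2}\mathbf{W}^n,\\ \mathbf{E}_3^{n+1}-\mathbf{E}_3^{n}&=\Delta t\,(A_1\mathbf{H}_2^{n+1/2}-A_2\mathbf{H}_1^{n+1/2})-\lambda\mathbf{H}_3^{n+1/2}\mathbf{W}^n,\\ \mathbf{H}_1^{n+1}-\mathbf{H}_1^{n}&=\Delta t\,(A_3\mathbf{E}_2^{n+1/2}-A_2\mathbf{E}_3^{n+1/2})+\lambda\mathbf{E}_1^{n+1/2}\mathbf{W}^n,\\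 \mathbf{H}_2^{n+1}-\mathbf{H}_2^{n}&=\Delta t\,(A_1\mathbf{E}_3^{n+1/2}-A_3\mathbf{E}_1^{n+1/2})+\lambda\mathbf{E}_2^{n+1/2}\mathbf{W}^n,\\ \mathbf{H}_3^{n+1}-\mathbf{H}_3^{n}&=\Delta t\,(A_2\mathbf{E}_1^{n+1/2}-A_1\mathbf{E}_2^{n+1/2})+\lambda\mathbf{E}_3^{n+1/2}\mathbf{W}^n, \end{aligned}$$ where products with $\mathbf{W}^n$ are componentwise and $(\mathbf{W}^n)_{i,j,k}=\Delta W_i^n$, with $\Delta W_i^n$ a real random variable approximating at the $i$-th grid point in $x$ the increment $W(t_{n+1})-W(t_n)$ of the driving $Q$-Wiener process (which depends spatially only on $x$). *)

theory Defs
  imports "HOL-Probability.Probability"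
begin

section \<open>The Daubechies scaling function and its autocorrelation\<close>

definition autocorrelation :: "(real \<Rightarrow> real) \<Rightarrow> real \<Rightarrow> real" where
  "autocorrelation \<phi> x = (LINT t|lborel. \<phi> t * \<phi> (t - x))"

text \<open>The filter is normalised as in \<open>\<phi> x = (\<Sum>k<\<gamma>. h k * \<phi> (2 * x - k))\<close>, i.e. its
  coefficients sum to 2.\<close>

definition wavelet :: "nat \<Rightarrow> (nat \<Rightarrow> real) \<Rightarrow> (real \<Rightarrow> real) \<Rightarrow> real \<Rightarrow> real" where
  "wavelet \<gamma> h \<phi> x = (\<Sum>k<\<gamma>. (- 1) ^ k * h (\<gamma> - 1 - k) * \<phi> (2 * x - real k))"

text \<open>Here the order \<open>\<gamma>\<close> is the length of the filter, so that the wavelet has \<open>\<gamma> / 2\<close>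
  vanishing moments, the maximal number for an orthonormal filter of that length.
  No choice of phase (extremal phase, least asymmetric, ...) is imposed on the filter:
  the autocorrelation function, which is all that the method uses, does not depend on it.\<close>

definition daubechies_scaling_function ::
    "nat \<Rightarrow> (nat \<Rightarrow> real) \<Rightarrow> (real \<Rightarrow> real) \<Rightarrow> bool" where
  "daubechies_scaling_function \<gamma> h \<phi> \<longleftrightarrow>
     (\<forall>k<\<gamma>. h k \<noteq> 0) \<and>
     (\<forall>x. \<phi> x = (\<Sum>k<\<gamma>. h k * \<phi> (2 * x - real k))) \<and>
     \<phi> \<in> borel_measurable borel \<and>
     integrable lborel (\<lambda>x. (\<phi> x)\<^sup>2) \<and>
     (\<forall>x. x \<notin> {0..real \<gamma> - 1} \<longrightarrow> \<phi> x = 0) \<and>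
     (LINT x|lborel. \<phi> x) = 1 \<and>
     (\<forall>l::int. (LINT t|lborel. \<phi> t * \<phi> (t - of_int l)) = (if l = 0 then 1 else 0)) \<and>
     (\<forall>p < \<gamma> div 2. (LINT x|lborel. x ^ p * wavelet \<gamma> h \<phi> x) = 0)"


section \<open>Differentiation matrices\<close>

text \<open>Rows and columns are numbered from 1 to \<open>N\<close>; the numbers are integers so that
  differences are not truncated.\<close>

definition diff_matrix ::
    "nat \<Rightarrow> (real \<Rightarrow> real) \<Rightarrow> int \<Rightarrow> nat \<Rightarrow> int \<Rightarrow> int \<Rightarrow> real" where
  "diff_matrix \<gamma> \<theta> J N m m' =
     (let r = int \<gamma> - 1; l = int N - (m - m'); l' = int N - (m' - m) in
      if m - r \<le> m' \<and> m' \<le> m + r then 2 powi J * deriv \<theta> (of_int (m - m'))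
      else if 1 \<le> l \<and> l \<le> r then 2 powi J * deriv \<theta> (of_int (- l))
      else if 1 \<le> l' \<and> l' \<le> r then 2 powi J * deriv \<theta> (of_int l')
      else 0)"


section \<open>Grid functions and the operators acting on them\<close>

text \<open>Integer indices allow the periodic reading of spatial indices; the grid points
  proper have indices between 1 and \<open>N\<close>. A vector field has the components 1, 2, 3.\<close>

type_synonym grid = "int \<Rightarrow> int \<Rightarrow> int \<Rightarrow> real"
type_synonym field3 = "nat \<Rightarrow> grid"

definition periodic_grid :: "nat \<Rightarrow> nat \<Rightarrow> nat \<Rightarrow> grid \<Rightarrow> bool" where
  "periodic_grid N1 N2 N3 v \<longleftrightarrow>
     (\<forall>i j k. v (i + int N1) j k = v i j k \<and> v i (j + int N2) k = v i j k \<and>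
              v i j (k + int N3) = v i j k)"

definition op1 :: "nat \<Rightarrow> (int \<Rightarrow> int \<Rightarrow> real) \<Rightarrow> grid \<Rightarrow> grid" where
  "op1 N B v i j k = (\<Sum>i'=1..int N. B i i' * v i' j k)"

definition op2 :: "nat \<Rightarrow> (int \<Rightarrow> int \<Rightarrow> real) \<Rightarrow> grid \<Rightarrow> grid" where
  "op2 N B v i j k = (\<Sum>j'=1..int N. B j j' * v i j' k)"

definition op3 :: "nat \<Rightarrow> (int \<Rightarrow> int \<Rightarrow> real) \<Rightarrow> grid \<Rightarrow> grid" where
  "op3 N B v i j k = (\<Sum>k'=1..int N. B k k' * v i j k')"


section \<open>The method\<close>

definition midpoint_field :: "field3 \<Rightarrow> field3 \<Rightarrow> field3" where
  "midpoint_field u v s i j k = (u s i j k + v s i j k) / 2"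

text \<open>One time step, from \<open>(E, H)\<close> to \<open>(E', H')\<close>; \<open>dW i\<close> is the noise increment, which
  depends on the first spatial index only.\<close>

definition wavelet_collocation_step ::
    "nat \<Rightarrow> nat \<Rightarrow> nat \<Rightarrow> (grid \<Rightarrow> grid) \<Rightarrow> (grid \<Rightarrow> grid) \<Rightarrow> (grid \<Rightarrow> grid) \<Rightarrow>
     real \<Rightarrow> real \<Rightarrow> (int \<Rightarrow> real) \<Rightarrow> field3 \<Rightarrow> field3 \<Rightarrow> field3 \<Rightarrow> field3 \<Rightarrow> bool" where
  "wavelet_collocation_step N1 N2 N3 A1 A2 A3 dt lam dW E H E' H' \<longleftrightarrow>
     (let Em = midpoint_field E E'; Hm = midpoint_field H H' in
      \<forall>i\<in>{1..int N1}. \<forall>j\<in>{1..int N2}. \<forall>k\<in>{1..int N3}.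
        E' 1 i j k - E 1 i j k =
          dt * (A2 (Hm 3) i j k - A3 (Hm 2) i j k) - lam * Hm 1 i j k * dW i \<and>
        E' 2 i j k - E 2 i j k =
          dt * (A3 (Hm 1) i j k - A1 (Hm 3) i j k) - lam * Hm 2 i j k * dW i \<and>
        E' 3 i j k - E 3 i j k =
          dt * (A1 (Hm 2) i j k - A2 (Hm 1) i j k) - lam * Hm 3 i j k * dW i \<and>
        H' 1 i j k - H 1 i j k =
          dt * (A3 (Em 2) i j k - A2 (Em 3) i j k) + lam * Em 1 i j k * dW i \<and>
        H' 2 i j k - H 2 i j k =
          dt * (A1 (Em 3) i j k - A3 (Em 1) i j k) + lam * Em 2 i j k * dW i \<and>
        H' 3 i j k - H 3 i j k =
          dt * (A2 (Em 1) i j k - A1 (Em 2) i j k) + lam * Em 3 i j k * dW i)"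

definition field_norm_sq ::
    "real \<Rightarrow> real \<Rightarrow> real \<Rightarrow> nat \<Rightarrow> nat \<Rightarrow> nat \<Rightarrow> field3 \<Rightarrow> real" where
  "field_norm_sq dx dy dz N1 N2 N3 u =
     dx * dy * dz * (\<Sum>i=1..int N1. \<Sum>j=1..int N2. \<Sum>k=1..int N3.
       (u 1 i j k)\<^sup>2 + (u 2 i j k)\<^sup>2 + (u 3 i j k)\<^sup>2)"

end

theory Submission
  imports Defs
begin

text \<open>The autocorrelation function is even, so its derivative is odd and the differentiation
  matrices are skew-symmetric. Testing the scheme with the midpoint fields turns the left-hand
  sides into differences of squares; on the right the discrete curls cancel by skew-symmetry,
  while the noise terms cancel pointwise between the electric and the magnetic equations.\<close>

text \<open>Translation invariance of Lebesgue measure: shifting \<open>t\<close> by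
  \<open>- x\<close> exchanges the two factors.\<close>

lemma autocorrelation_minus: "autocorrelation \<phi> (- x) = autocorrelation \<phi> x"
proof -
  have "(LINT t|lborel. \<phi> t * \<phi> (t + x)) = (LINT t|lborel. \<phi> (t - x) * \<phi> t)"
    using lborel_integral_real_affine[of 1 "\<lambda>t. \<phi> t * \<phi> (t + x)" "- x"] by simp
  then show ?thesis
    by (simp add: autocorrelation_def mult.commute)
qed

text \<open>Chain rule for \<open>f (- y) = f y\<close>. Differentiability ensures that
  \<open>deriv f x\<close> is a genuine derivative rather than an unspecified value.\<close>

lemma deriv_even_function:
  fixes f :: "real \<Rightarrow> real"
  assumes even: "\<And>x. f (- x) = f x" and diff: "f differentiable at x"
  shows "deriv f (- x) = - deriv f x"
proof -
  have "(f has_field_derivative deriv f x) (at (- (- x)))"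
    using diff by (simp add: DERIV_deriv_iff_real_differentiable)
  then have "((\<lambda>y. f (- y)) has_field_derivative - deriv f x) (at (- x))"
    by (simp add: DERIV_mirror)
  then show ?thesis
    by (intro DERIV_imp_deriv) (simp add: even)
qed

text \<open>Transposition maps the central band to itself and exchanges the two periodic corner
  blocks; in each case the argument of \<open>deriv \<theta>\<close> changes sign. The bound on
  \<open>N\<close> keeps band and corners disjoint. On the diagonal, oddness forces the value
  0.\<close>

lemma diff_matrix_skew:
  assumes odd: "\<And>x. deriv \<theta> (- x) = - deriv \<theta> x"
    and N: "N \<ge> 2 * \<gamma> - 1"
  shows "diff_matrix \<gamma> \<theta> J N m' m = - diff_matrix \<gamma> \<theta> J N m m'"
proof -
  have "deriv \<theta> (real_of_int m' - real_of_int m) = - deriv \<theta> (real_of_int m - real_of_int m')"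
    using odd[of "real_of_int m - real_of_int m'"] by simp
  \<comment> \<open>Corner entries: with \<open>l = N - (m - m')\<close> the left argument is
    \<open>- l\<close>, and the transposed entry has \<open>l\<close> as its \<open>l'\<close>. The
    next fact is the opposite corner.\<close>
  moreover have "deriv \<theta> (real_of_int m - real_of_int m' - real N)
      = - deriv \<theta> (real N + real_of_int m' - real_of_int m)"
    using odd[of "real N + real_of_int m' - real_of_int m"] by (simp add: algebra_simps)
  moreover have "deriv \<theta> (real_of_int m' - real_of_int m - real N)
      = - deriv \<theta> (real N + real_of_int m - real_of_int m')"
    using odd[of "real N + real_of_int m - real_of_int m'"] by (simp add: algebra_simps)
  ultimately show ?thesis
    using N by (auto simp: diff_matrix_def Let_def algebra_simps)
qed

text \<open>Interchanging the sums in the second term transposes \<open>B\<close>, and skewness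
  makes it the negative of the first.\<close>

lemma skew_bilinear_sum:
  fixes B :: "'a \<Rightarrow> 'a \<Rightarrow> real"
  assumes "\<And>i i'. B i' i = - B i i'"
  shows "(\<Sum>i\<in>S. a i * (\<Sum>i'\<in>S. B i i' * b i') + b i * (\<Sum>i'\<in>S. B i i' * a i')) = 0"
proof -
  have "(\<Sum>i\<in>S. \<Sum>i'\<in>S. b i * (B i i' * a i')) = (\<Sum>i\<in>S. \<Sum>i'\<in>S. b i' * (B i' i * a i))"
    by (rule sum.swap)
  also have "\<dots> = (\<Sum>i\<in>S. \<Sum>i'\<in>S. - (a i * (B i i' * b i')))"
    by (intro sum.cong refl) (subst assms, simp)
  finally show ?thesis
    by (simp add: sum.distrib sum_distrib_left sum_negf)
qed

definition grid_sum :: "nat \<Rightarrow> nat \<Rightarrow> nat \<Rightarrow> grid \<Rightarrow> real" where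
  "grid_sum N1 N2 N3 f = (\<Sum>i=1..int N1. \<Sum>j=1..int N2. \<Sum>k=1..int N3. f i j k)"

lemma grid_sum_add:
  "grid_sum N1 N2 N3 (\<lambda>i j k. f i j k + g i j k) = grid_sum N1 N2 N3 f + grid_sum N1 N2 N3 g"
  by (simp add: grid_sum_def sum.distrib)

lemma grid_sum_diff:
  "grid_sum N1 N2 N3 (\<lambda>i j k. f i j k - g i j k) = grid_sum N1 N2 N3 f - grid_sum N1 N2 N3 g"
  by (simp add: grid_sum_def sum_subtractf)

lemma grid_sum_cmult:
  "grid_sum N1 N2 N3 (\<lambda>i j k. c * f i j k) = c * grid_sum N1 N2 N3 f"
  by (simp add: grid_sum_def sum_distrib_left)

lemma grid_sum_cong:
  assumes "\<And>i j k. i \<in> {1..int N1} \<Longrightarrow> j \<in> {1..int N2} \<Longrightarrow> k \<in> {1..int N3} \<Longrightarrow> f i j k = g i j k"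
  shows "grid_sum N1 N2 N3 f = grid_sum N1 N2 N3 g"
  unfolding grid_sum_def by (intro sum.cong refl assms)

text \<open>Skew-adjointness for the discrete inner product: summation by parts without boundary
  terms.\<close>

definition skew_operator :: "nat \<Rightarrow> nat \<Rightarrow> nat \<Rightarrow> (grid \<Rightarrow> grid) \<Rightarrow> bool" where
  "skew_operator N1 N2 N3 A \<longleftrightarrow>
     (\<forall>u v. grid_sum N1 N2 N3 (\<lambda>i j k. u i j k * A v i j k + v i j k * A u i j k) = 0)"

lemma skew_operator_op3:
  assumes "\<And>i i'. B i' i = - B i i'"
  shows "skew_operator N1 N2 N3 (op3 N3 B)"
  unfolding skew_operator_def grid_sum_def op3_def
  using skew_bilinear_sum[of B, OF assms] by simp

text \<open>\<open>skew_bilinear_sum\<close> needs the direction of the operator as the innermost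
  sum, so for fixed \<open>i\<close> the sums over \<open>j\<close> and \<open>k\<close> are
  interchanged.\<close>

lemma skew_operator_op2:
  assumes "\<And>i i'. B i' i = - B i i'"
  shows "skew_operator N1 N2 N3 (op2 N2 B)"
  unfolding skew_operator_def grid_sum_def op2_def
proof (intro allI)
  fix u v :: grid
  have "(\<Sum>j=1..int N2. \<Sum>k=1..int N3.
      u i j k * (\<Sum>j'=1..int N2. B j j' * v i j' k) +
      v i j k * (\<Sum>j'=1..int N2. B j j' * u i j' k)) = 0" for i
    by (subst sum.swap) (simp add: skew_bilinear_sum[of B, OF assms])
  then show "(\<Sum>i=1..int N1. \<Sum>j=1..int N2. \<Sum>k=1..int N3.
      u i j k * (\<Sum>j'=1..int N2. B j j' * v i j' k) +
      v i j k * (\<Sum>j'=1..int N2. B j j' * u i j' k)) = 0"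
    by simp
qed

lemma skew_operator_op1:
  assumes "\<And>i i'. B i' i = - B i i'"
  shows "skew_operator N1 N2 N3 (op1 N1 B)"
  unfolding skew_operator_def grid_sum_def op1_def
proof (intro allI)
  fix u v :: grid
  have "(\<Sum>i=1..int N1. \<Sum>k=1..int N3.
      u i j k * (\<Sum>i'=1..int N1. B i i' * v i' j k) +
      v i j k * (\<Sum>i'=1..int N1. B i i' * u i' j k)) = 0" for j
    by (subst sum.swap) (simp add: skew_bilinear_sum[of B, OF assms])
  \<comment> \<open>The sum over \<open>i\<close> has to pass two others: here \<open>j\<close> is
    moved outside, while the fact above has already dealt with \<open>k\<close> for fixed
    \<open>j\<close>.\<close>
  then show "(\<Sum>i=1..int N1. \<Sum>j=1..int N2. \<Sum>k=1..int N3.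
      u i j k * (\<Sum>i'=1..int N1. B i i' * v i' j k) +
      v i j k * (\<Sum>i'=1..int N1. B i i' * u i' j k)) = 0"
    by (subst sum.swap) simp
qed

text \<open>The pathwise statement: \<open>dW\<close> is an arbitrary real function of
  \<open>i\<close>, and the operators enter through skewness.\<close>

lemma energy_conservation:
  assumes A1: "skew_operator N1 N2 N3 A1" and A2: "skew_operator N1 N2 N3 A2"
    and A3: "skew_operator N1 N2 N3 A3"
    and step: "wavelet_collocation_step N1 N2 N3 A1 A2 A3 dt lam dW E H E' H'"
  shows "field_norm_sq dx dy dz N1 N2 N3 E' + field_norm_sq dx dy dz N1 N2 N3 H' =
    field_norm_sq dx dy dz N1 N2 N3 E + field_norm_sq dx dy dz N1 N2 N3 H"
proof -
  define Em Hm where "Em = midpoint_field E E'" and "Hm = midpoint_field H H'"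
  define e where "e u i j k = (u 1 i j k)\<^sup>2 + (u 2 i j k)\<^sup>2 + (u 3 i j k)\<^sup>2"
    for u :: field3 and i j k
  \<comment> \<open>\<open>c A u v\<close> is itself a grid function, so \<open>skew\<close> applies
    directly once the grid sum is split by linearity.\<close>
  define c where
    "c A u v i j k = u i j k * A v i j k + v i j k * A u i j k" for A :: "grid \<Rightarrow> grid" and u v i j k
  have skew: "grid_sum N1 N2 N3 (c A1 u v) = 0" "grid_sum N1 N2 N3 (c A2 u v) = 0"
    "grid_sum N1 N2 N3 (c A3 u v) = 0" for u v
    using A1 A2 A3 by (simp_all add: skew_operator_def c_def[abs_def])
  \<comment> \<open>Each operator occurs in four equations; they pair up, an electric with a
    magnetic one, into two \<open>c\<close> terms of opposite sign. The noise products
    \<open>lam * Em s i j k * Hm s i j k * dW i\<close> occur once with each sign.\<close>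
  have point: "e E' i j k + e H' i j k - (e E i j k + e H i j k) =
      (2 * dt) * (c A1 (Em 3) (Hm 2) i j k - c A1 (Em 2) (Hm 3) i j k
        + (c A2 (Em 1) (Hm 3) i j k - c A2 (Em 3) (Hm 1) i j k)
        + (c A3 (Em 2) (Hm 1) i j k - c A3 (Em 1) (Hm 2) i j k))"
    if "i \<in> {1..int N1}" "j \<in> {1..int N2}" "k \<in> {1..int N3}" for i j k
  proof -
    note s = step[unfolded wavelet_collocation_step_def Let_def, folded Em_def Hm_def,
        rule_format, OF that]
    \<comment> \<open>Source of the factor 2 in \<open>2 * dt\<close>: the sum of old and new value
      is twice the midpoint.\<close>
    have sq: "(u' s i j k)\<^sup>2 - (u s i j k)\<^sup>2
        = 2 * midpoint_field u u' s i j k * (u' s i j k - u s i j k)" for u u' :: field3 and s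
      by (simp add: midpoint_field_def power2_eq_square algebra_simps)
    have "e E' i j k + e H' i j k - (e E i j k + e H i j k) =
        ((E' 1 i j k)\<^sup>2 - (E 1 i j k)\<^sup>2) + ((E' 2 i j k)\<^sup>2 - (E 2 i j k)\<^sup>2)
        + ((E' 3 i j k)\<^sup>2 - (E 3 i j k)\<^sup>2) + ((H' 1 i j k)\<^sup>2 - (H 1 i j k)\<^sup>2)
        + ((H' 2 i j k)\<^sup>2 - (H 2 i j k)\<^sup>2) + ((H' 3 i j k)\<^sup>2 - (H 3 i j k)\<^sup>2)"
      by (simp add: e_def)
    also have "\<dots> = (2 * dt) * (c A1 (Em 3) (Hm 2) i j k - c A1 (Em 2) (Hm 3) i j k
        + (c A2 (Em 1) (Hm 3) i j k - c A2 (Em 3) (Hm 1) i j k)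
        + (c A3 (Em 2) (Hm 1) i j k - c A3 (Em 1) (Hm 2) i j k))"
      \<comment> \<open>The scheme replaces the increments first, before arithmetic can break up the
        differences on its left-hand sides.\<close>
      unfolding sq Em_def[symmetric] Hm_def[symmetric] c_def by (simp only: s) (simp add: algebra_simps)
    finally show ?thesis .
  qed
  have "grid_sum N1 N2 N3 (\<lambda>i j k. e E' i j k + e H' i j k - (e E i j k + e H i j k)) = 0"
    by (subst grid_sum_cong[OF point])
      (simp_all only: grid_sum_cmult grid_sum_add grid_sum_diff skew, simp)
  then have "grid_sum N1 N2 N3 (e E') + grid_sum N1 N2 N3 (e H') =
      grid_sum N1 N2 N3 (e E) + grid_sum N1 N2 N3 (e H)"
    by (simp add: grid_sum_add grid_sum_diff)
  moreover have "field_norm_sq dx dy dz N1 N2 N3 u = dx * dy * dz * grid_sum N1 N2 N3 (e u)" for u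
    by (simp add: field_norm_sq_def grid_sum_def e_def)
  ultimately show ?thesis
    by (simp flip: distrib_left)
qed

theorem theorem3p2:
  fixes M :: "'w measure"
    and L1 L2 L3 :: real and J1 J2 J3 :: int and N1 N2 N3 :: nat
    and dx dy dz dt lam :: real
    and \<gamma> :: nat and h :: "nat \<Rightarrow> real" and \<phi> \<theta> :: "real \<Rightarrow> real"
    and A1 A2 A3 :: "grid \<Rightarrow> grid"
    and dW :: "nat \<Rightarrow> int \<Rightarrow> 'w \<Rightarrow> real"
    and E H :: "nat \<Rightarrow> 'w \<Rightarrow> field3"
  assumes "prob_space M"
    and "L1 > 0" and "L2 > 0" and "L3 > 0"
    and "real N1 = L1 * 2 powi J1" and "real N2 = L2 * 2 powi J2" and "real N3 = L3 * 2 powi J3"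
    and "dx = 2 powi (- J1)" and "dy = 2 powi (- J2)" and "dz = 2 powi (- J3)"
    and "dt > 0" and "lam \<ge> 0"
    and "\<gamma> > 0" and "even \<gamma>" and "daubechies_scaling_function \<gamma> h \<phi>"
    and "\<theta> = autocorrelation \<phi>" and "\<forall>x. \<theta> differentiable at x"
    and "N1 \<ge> 2 * \<gamma> - 1" and "N2 \<ge> 2 * \<gamma> - 1" and "N3 \<ge> 2 * \<gamma> - 1"
    and "A1 = op1 N1 (diff_matrix \<gamma> \<theta> J1 N1)"
    and "A2 = op2 N2 (diff_matrix \<gamma> \<theta> J2 N2)"
    and "A3 = op3 N3 (diff_matrix \<gamma> \<theta> J3 N3)"
    and "\<forall>n. \<forall>i\<in>{1..int N1}. dW n i \<in> borel_measurable M"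
    and "\<forall>n. AE \<omega> in M. \<forall>s\<in>{1, 2, 3}.
           periodic_grid N1 N2 N3 (E n \<omega> s) \<and> periodic_grid N1 N2 N3 (H n \<omega> s)"
    and "\<forall>n. AE \<omega> in M. wavelet_collocation_step N1 N2 N3 A1 A2 A3 dt lam (\<lambda>i. dW n i \<omega>)
           (E n \<omega>) (H n \<omega>) (E (n + 1) \<omega>) (H (n + 1) \<omega>)"
  shows "\<forall>n. AE \<omega> in M.
           field_norm_sq dx dy dz N1 N2 N3 (E (n + 1) \<omega>) +
           field_norm_sq dx dy dz N1 N2 N3 (H (n + 1) \<omega>) =
           field_norm_sq dx dy dz N1 N2 N3 (E n \<omega>) + field_norm_sq dx dy dz N1 N2 N3 (H n \<omega>)"
proof
  fix n
  have odd: "deriv \<theta> (- x) = - deriv \<theta> x" for x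
    using assms(16,17) by (intro deriv_even_function) (simp_all add: autocorrelation_minus)
  have "skew_operator N1 N2 N3 A1" "skew_operator N1 N2 N3 A2" "skew_operator N1 N2 N3 A3"
    unfolding assms(21-23)
    by (intro skew_operator_op1 skew_operator_op2 skew_operator_op3
        diff_matrix_skew odd assms(18-20))+
  note energy = energy_conservation[OF this]
  \<comment> \<open>For fixed \<open>\<omega>\<close> the increments are real numbers, so
    \<open>energy\<close> holds outside the null set on which the step fails.\<close>
  from assms(26) have "AE \<omega> in M. wavelet_collocation_step N1 N2 N3 A1 A2 A3 dt lam
      (\<lambda>i. dW n i \<omega>) (E n \<omega>) (H n \<omega>) (E (n + 1) \<omega>) (H (n + 1) \<omega>)" ..
  then show "AE \<omega> in M.
      field_norm_sq dx dy dz N1 N2 N3 (E (n + 1) \<omega>) +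
      field_norm_sq dx dy dz N1 N2 N3 (H (n + 1) \<omega>) =
      field_norm_sq dx dy dz N1 N2 N3 (E n \<omega>) + field_norm_sq dx dy dz N1 N2 N3 (H n \<omega>)"
    by eventually_elim (rule energy)
qed

end
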